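(* There exists a deterministic one-round algorithm for $\textsc{MemList}(K_3)$ under edge insertions with bandwidth $O(\Delta^2 \log \log n)$, where $\Delta$ is the maximum degree of the dynamic network.
   Context: Dynamic network model: a dynamic network is a sequence of graphs $G^0, G^1, \ldots$ on $n$ nodes, where each $G^i$ ($i \ge 1$) is either identical to $G^{i-1}$ or obtained from it by a single edge insertion. Nodes have distinct identifiers from $[n]$, each node knows the identifiers of its current neighbors, and every node initially knows the entire topology of $G^0$. Communication is synchronous: in each round the topological change (if any) happens first, then each node may send a $B$-bit message to each of its current neighbors; $B$ is the bandwidth. A node learns of changes only by comparing its neighbor list between consecutive rounds. A one-round algorithm must, after each round's topological change and that round's communication, output correctly for the current graph. $\textsc{MemList}(H)$: every node $v$ must list all subgraphs of the current graph that are isomorphic to $H$ and contain $v$. $K_3$ is the triangle. The maximum degree $\Delta$ of a dynamic network is the maximum degree over all graphs in the sequence. *)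

theory Defs
  imports Complex_Main "HOL-Library.Landau_Symbols"
begin

record 'a ugraph =
  verts :: "'a set"
  edges :: "'a set set"

definition simple_graph :: "'a ugraph \<Rightarrow> bool" where
  "simple_graph G \<longleftrightarrow> finite (verts G) \<and> (\<forall>e\<in>edges G. e \<subseteq> verts G \<and> card e = 2)"

definition nbrs :: "'a ugraph \<Rightarrow> 'a \<Rightarrow> 'a set" where
  "nbrs G v = {u. {u, v} \<in> edges G}"

definition subgraph :: "'a ugraph \<Rightarrow> 'a ugraph \<Rightarrow> bool" where
  "subgraph S G \<longleftrightarrow> simple_graph S \<and> verts S \<subseteq> verts G \<and> edges S \<subseteq> edges G"

definition isomorphic :: "'a ugraph \<Rightarrow> 'b ugraph \<Rightarrow> bool" where
  "isomorphic G H \<longleftrightarrow> (\<exists>f. bij_betw f (verts G) (verts H) \<and> edges H = (\<lambda>e. f ` e) ` edges G)"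

definition complete_graph :: "nat \<Rightarrow> nat ugraph" where
  "complete_graph k = \<lparr>verts = {1..k}, edges = {e. e \<subseteq> {1..k} \<and> card e = 2}\<rparr>"

definition edge_insertion :: "'a ugraph \<Rightarrow> 'a ugraph \<Rightarrow> bool" where
  "edge_insertion G G' \<longleftrightarrow>
     (\<exists>u\<in>verts G. \<exists>v\<in>verts G. u \<noteq> v \<and> {u, v} \<notin> edges G \<and>
        verts G' = verts G \<and> edges G' = insert {u, v} (edges G))"

definition dynamic_network :: "nat \<Rightarrow> (nat \<Rightarrow> nat ugraph) \<Rightarrow> bool" where
  "dynamic_network n G \<longleftrightarrow>
     simple_graph (G 0) \<and> verts (G 0) = {1..n} \<and>
     (\<forall>i. G (Suc i) = G i \<or> edge_insertion (G i) (G (Suc i)))"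

text \<open>On a dynamic network all degrees are below \<open>n\<close>, so this supremum of natural numbers is a
  maximum; it is \<open>0\<close> for \<open>n = 0\<close>.\<close>

definition max_degree :: "(nat \<Rightarrow> nat ugraph) \<Rightarrow> nat" where
  "max_degree G = Sup {card (nbrs (G i) v) | i v. v \<in> verts (G i)}"

text \<open>Messages are bit strings; sending nothing is the same as sending the empty string.\<close>

type_synonym message = "bool list"

text \<open>What a node observes in one round: its current neighbours, and the message received from each
  of them (\<open>[]\<close> for nodes that are not neighbours).\<close>

type_synonym observation = "nat set \<times> (nat \<Rightarrow> message)"

text \<open>Local computation is unrestricted, so instead of an explicit local state an algorithm works on
  everything a node has seen: its identifier, the initial graph (hence also \<open>n\<close>), and its
  observations in all earlier rounds, oldest first. In \<open>send A v G0 h N u\<close> the set \<open>N\<close> is the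
  neighbourhood of \<open>v\<close> after the topological change of the current round, and \<open>u\<close> is the recipient.
  The history passed to \<open>out\<close> includes the current round. Neither function is given the maximum
  degree of the dynamic network.\<close>

record algorithm =
  send :: "nat \<Rightarrow> nat ugraph \<Rightarrow> observation list \<Rightarrow> nat set \<Rightarrow> nat \<Rightarrow> message"
  out :: "nat \<Rightarrow> nat ugraph \<Rightarrow> observation list \<Rightarrow> nat ugraph set"

text \<open>\<open>history A G i v\<close> lists the observations of \<open>v\<close> in rounds \<open>1, \<dots>, i\<close>; in round \<open>i + 1\<close> the graph
  changes from \<open>G i\<close> to \<open>G (i + 1)\<close> before the messages are sent.\<close>

fun history :: "algorithm \<Rightarrow> (nat \<Rightarrow> nat ugraph) \<Rightarrow> nat \<Rightarrow> nat \<Rightarrow> observation list" where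
  "history A G 0 v = []"
| "history A G (Suc i) v = history A G i v @
     [(nbrs (G (Suc i)) v,
       \<lambda>u. if u \<in> nbrs (G (Suc i)) v
           then send A u (G 0) (history A G i u) (nbrs (G (Suc i)) u) v
           else [])]"

text \<open>Indexed like \<open>history\<close>: this is the message from \<open>u\<close> to \<open>v\<close> in round \<open>i + 1\<close>.\<close>

definition sent :: "algorithm \<Rightarrow> (nat \<Rightarrow> nat ugraph) \<Rightarrow> nat \<Rightarrow> nat \<Rightarrow> nat \<Rightarrow> message" where
  "sent A G i u v = send A u (G 0) (history A G i u) (nbrs (G (Suc i)) u) v"

definition respects_bandwidth :: "algorithm \<Rightarrow> (nat \<Rightarrow> nat ugraph) \<Rightarrow> nat \<Rightarrow> bool" where
  "respects_bandwidth A G B \<longleftrightarrow>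
     (\<forall>i. \<forall>u\<in>verts (G (Suc i)). \<forall>v\<in>nbrs (G (Suc i)) u. length (sent A G i u v) \<le> B)"

definition mem_list :: "'b ugraph \<Rightarrow> 'a ugraph \<Rightarrow> 'a \<Rightarrow> 'a ugraph set" where
  "mem_list H G v = {S. subgraph S G \<and> isomorphic S H \<and> v \<in> verts S}"

definition one_round_MemList :: "'b ugraph \<Rightarrow> algorithm \<Rightarrow> (nat \<Rightarrow> nat ugraph) \<Rightarrow> bool" where
  "one_round_MemList H A G \<longleftrightarrow>
     (\<forall>i\<ge>1. \<forall>v\<in>verts (G i). out A v (G 0) (history A G i v) = mem_list H (G i) v)"

end

theory Submission
  imports Defs "HOL-Library.Discrete_Functions" "HOL-Real_Asymp.Real_Asymp"
begin

text \<open>At most one edge is inserted per round, so a round number identifies an inserted edge, and an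
  edge inserted less than \<open>L \<approx> log n\<close> rounds ago is named by its age, which takes only \<open>O(log log n)\<close>
  bits. In every round, a node broadcasts the ages of its own recent edges, the ages of its
  neighbours' recent edges (as they were announced one round earlier), and, for each neighbour
  acquired since the beginning, one bit of its identifier, cycling through the \<open>L\<close> bit positions.

  Let \<open>w\<close> have neighbours \<open>x\<close> and \<open>y\<close>, where \<open>x\<close> was a neighbour before \<open>y\<close> or both were initial
  ones, and let \<open>xy\<close> be an inserted edge. If \<open>w\<close> is adjacent to both while \<open>xy\<close> is recent, then it
  hears the same age from \<open>x\<close> and \<open>y\<close>. Otherwise consider the round in which \<open>y\<close> becomes a neighbour
  of \<open>w\<close>. If \<open>wx\<close> is recent then, \<open>y\<close> relays the age of \<open>wx\<close>; as \<open>y\<close> was not adjacent to \<open>w\<close>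
  before, it can only have learned it from \<open>x\<close>. If \<open>wx\<close> and \<open>xy\<close> are both old, \<open>x\<close> has already
  spelled out the identifier of \<open>y\<close> to \<open>w\<close>.\<close>

section \<open>Fixed-width codes\<close>

definition encode :: "nat \<Rightarrow> nat list \<Rightarrow> bool list" where
  "encode w xs = concat (map (\<lambda>x. map (bit x) [0..<w]) xs)"

text \<open>Local computation is unrestricted, so any inverse of the encoding will do.\<close>

definition decode :: "nat \<Rightarrow> bool list \<Rightarrow> nat list" where
  "decode w = inv_into (lists {..<2 ^ w}) (encode w)"

lemma length_encode: "length (encode w xs) = w * length xs"
  by (induction xs) (simp_all add: encode_def)

lemma eq_if_bits_eq:
  fixes x y :: nat
  assumes "x < 2 ^ w" "y < 2 ^ w" "\<And>i. i < w \<Longrightarrow> bit x i = bit y i"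
  shows "x = y"
proof -
  have "take_bit w x = take_bit w y"
    using assms(3) by (auto simp: bit_eq_iff bit_take_bit_iff)
  then show ?thesis
    using assms(1,2) by (simp add: take_bit_nat_eq_self)
qed

text \<open>A positive width makes the length of a code reveal the number of entries; equal blocks
  then give equal entries.\<close>

lemma inj_on_encode:
  assumes "w > 0"
  shows "inj_on (encode w) (lists {..<2 ^ w})"
proof (rule inj_onI)
  fix xs ys
  assume "xs \<in> lists {..<2 ^ w}" "ys \<in> lists {..<2 ^ w}" "encode w xs = encode w ys"
  then show "xs = ys"
  proof (induction xs arbitrary: ys rule: list.induct)
    case Nil
    then have "w * length ys = 0"
      by (metis length_encode list.size(3) mult_0_right)
    with assms show ?case by simp
  next
    case (Cons x xs)
    have "w * length ys = w * length (x # xs)"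
      using Cons.prems(3) by (metis length_encode)
    then obtain y ys' where ys: "ys = y # ys'"
      using assms by (cases ys) auto
    have "map (bit x) [0..<w] = map (bit y) [0..<w] \<and> encode w xs = encode w ys'"
      using Cons.prems(3) by (simp add: ys encode_def)
    then have "x = y" "xs = ys'"
      using Cons.prems(1,2) Cons.IH[of ys'] by (auto simp: ys intro!: eq_if_bits_eq[of x w y])
    then show ?case by (simp add: ys)
  qed
qed

lemma decode_encode:
  assumes "w > 0" "set xs \<subseteq> {..<2 ^ w}"
  shows "decode w (encode w xs) = xs"
  unfolding decode_def using assms by (intro inv_into_f_f inj_on_encode) auto

text \<open>This is the \<open>L\<close> of the algorithm: the number of identifier bits and also
  the age limit for recent edges, so that an edge stops being recent just when a full identifier can
  have been spelled out.\<close>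

definition id_bits :: "nat \<Rightarrow> nat" where
  "id_bits n = Suc (floor_log n)"

text \<open>Wide enough for every code of a signal, the largest being \<open>2 * L + 2\<close> with
  \<open>L = id_bits n\<close>.\<close>

definition code_bits :: "nat \<Rightarrow> nat" where
  "code_bits n = Suc (floor_log (2 * id_bits n + 3))"

lemma less_exp_Suc_floor_log: "n < 2 ^ Suc (floor_log n)"
proof (cases "n = 0")
  case False
  then show ?thesis using floor_log_exp2_gt[of n] by simp
qed simp

lemma code_bits_asymp: "(\<lambda>n. real (code_bits n)) \<in> O(\<lambda>n. ln (ln (real n)))"
proof -
  have le: "real (floor_log m) \<le> log 2 (real m)" if "m > 0" for m
    using floor_log_exp2_le[OF that] by (rule le_log2_of_power)
  have "real (code_bits n) \<le> 1 + log 2 (5 + 2 * log 2 (real n))" if "n > 0" for n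
  proof -
    have "real (code_bits n) \<le> 1 + log 2 (real (2 * id_bits n + 3))"
      using le[of "2 * id_bits n + 3"] by (simp add: code_bits_def)
    also have "\<dots> \<le> 1 + log 2 (5 + 2 * log 2 (real n))"
      using le[OF that] by (simp add: id_bits_def)
    finally show ?thesis .
  qed
  then have "(\<lambda>n. real (code_bits n)) \<in> O(\<lambda>n. 1 + log 2 (5 + 2 * log 2 (real n)))"
    by (intro landau_o.big_mono eventually_mono[OF eventually_gt_at_top[of 0]])
      (auto intro: order_trans[OF _ abs_ge_self])
  also have "(\<lambda>n. 1 + log 2 (5 + 2 * log 2 (real n))) \<in> O(\<lambda>n. ln (ln (real n)))"
    by real_asymp
  finally show ?thesis .
qed

section \<open>Cliques through a vertex\<close>

text \<open>In a copy of a clique through \<open>v\<close>, every edge contains \<open>v\<close> or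
  joins two neighbours of \<open>v\<close>, so the remaining edges have no influence.\<close>

lemma mem_list_complete_graph_cong:
  assumes "verts G = verts G'"
    and "\<And>x. {x, v} \<in> edges G \<longleftrightarrow> {x, v} \<in> edges G'"
    and "\<And>x y. {x, v} \<in> edges G \<Longrightarrow> {y, v} \<in> edges G \<Longrightarrow> x \<noteq> y \<Longrightarrow>
      {x, y} \<in> edges G \<longleftrightarrow> {x, y} \<in> edges G'"
  shows "mem_list (complete_graph k) G v = mem_list (complete_graph k) G' v"
proof -
  \<comment> \<open>Stated for arbitrary graphs so as to serve both directions.\<close>
  have *: "subgraph S G'"
    if S: "subgraph S G" "isomorphic S (complete_graph k)" "v \<in> verts S"
      and V: "verts G = verts G'"
      and E: "\<And>x. {x, v} \<in> edges G \<longleftrightarrow> {x, v} \<in> edges G'"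
      "\<And>x y. {x, v} \<in> edges G \<Longrightarrow> {y, v} \<in> edges G \<Longrightarrow> x \<noteq> y \<Longrightarrow>
        {x, y} \<in> edges G \<longleftrightarrow> {x, y} \<in> edges G'"
    for S and G G' :: "'a ugraph"
  proof -
    obtain f where f: "bij_betw f (verts S) {1..k}"
      "{e. e \<subseteq> {1..k} \<and> card e = 2} = (\<lambda>e. f ` e) ` edges S"
      using S(2) by (auto simp: isomorphic_def complete_graph_def)
    have adj: "{x, v} \<in> edges S" if "x \<in> verts S" "x \<noteq> v" for x
    proof -
      have "f x \<noteq> f v"
        using f(1) that S(3) by (auto simp: bij_betw_def inj_on_def)
      then have "{f x, f v} \<in> {e. e \<subseteq> {1..k} \<and> card e = 2}"
        using f(1) that S(3) by (auto simp: bij_betw_def)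
      then have "f ` {x, v} \<in> (\<lambda>e. f ` e) ` edges S"
        by (simp only: f(2) image_insert image_empty)
      then obtain e where e: "e \<in> edges S" "f ` e = f ` {x, v}"
        by (metis imageE)
      then have "e \<subseteq> verts S"
        using S(1) by (auto simp: subgraph_def simple_graph_def)
      then have "e = {x, v}"
        using e(2) f(1) that S(3) by (metis bij_betw_def empty_subsetI inj_on_image_eq_iff insert_subset)
      with e show ?thesis by simp
    qed
    have "e \<in> edges G'" if e: "e \<in> edges S" for e
    proof -
      obtain x y where xy: "e = {x, y}" "x \<noteq> y" "x \<in> verts S" "y \<in> verts S"
        using S(1) e by (auto simp: subgraph_def simple_graph_def card_2_iff)
      have "e \<in> edges G"
        using e S(1) by (auto simp: subgraph_def)
      show ?thesis
      proof (cases "x = v \<or> y = v")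
        case True
        then show ?thesis
          using E(1)[of x] E(1)[of y] \<open>e \<in> edges G\<close> xy by (auto simp: insert_commute)
      next
        case False
        then have "{x, v} \<in> edges G" "{y, v} \<in> edges G"
          using adj xy S(1) by (auto simp: subgraph_def)
        then show ?thesis
          using E(2) \<open>e \<in> edges G\<close> xy by auto
      qed
    qed
    then show ?thesis
      using S(1) V by (auto simp: subgraph_def)
  qed
  have "subgraph S G \<longleftrightarrow> subgraph S G'" if "isomorphic S (complete_graph k)" "v \<in> verts S" for S
    using *[of S G G', OF _ that assms] *[of S G' G, OF _ that] assms by metis
  then show ?thesis
    unfolding mem_list_def by blast
qed

section \<open>The algorithm\<close>

text \<open>Throughout, \<open>M j\<close> is the neighbourhood of a node in the \<open>j\<close>-th graph, and the observation
  with index \<open>k\<close> is that of round \<open>k + 1\<close>. An edge that is new in round \<open>j + 1\<close> has age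
  \<open>k - j\<close> in round \<open>k + 1\<close>.\<close>

definition ages :: "nat \<Rightarrow> (nat \<Rightarrow> 'a set) \<Rightarrow> nat \<Rightarrow> nat list" where
  "ages L M k = filter (\<lambda>a. a \<le> k \<and> M (k - a) \<noteq> M (Suc (k - a))) [0..<L]"

text \<open>A list in order of acquisition, so that a neighbour keeps its position and its bits from
  different rounds can be matched.\<close>

definition arrivals :: "(nat \<Rightarrow> 'a::linorder set) \<Rightarrow> nat \<Rightarrow> 'a list" where
  "arrivals M k = concat (map (\<lambda>j. sorted_list_of_set (M (Suc j) - M j)) [0..<Suc k])"

text \<open>\<open>R y\<close> holds the ages announced by \<open>y\<close> one round earlier. Each
  has grown by one since, hence \<open>a - 1\<close> and the range from 1 to
  \<open>L\<close>.\<close>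

definition relayed :: "nat \<Rightarrow> (nat \<Rightarrow> nat set) \<Rightarrow> nat set \<Rightarrow> nat list" where
  "relayed L R N = filter (\<lambda>a. \<exists>y\<in>N. a - 1 \<in> R y) [1..<Suc L]"

text \<open>The codes below \<open>L\<close> are the ages of the sender's own edges, those from \<open>L + 1\<close> to \<open>2 * L\<close> the
  shifted ages of edges at its neighbours, and \<open>2 * L + 1\<close> and \<open>2 * L + 2\<close> are bits of identifiers.\<close>

definition signal :: "nat \<Rightarrow> (nat \<Rightarrow> nat set) \<Rightarrow> nat list \<Rightarrow> nat \<Rightarrow> nat list" where
  "signal L M as k = ages L M k @ map ((+) L) as @
     map (\<lambda>y. 2 * L + 1 + of_bool (bit y (k mod L))) (arrivals M k)"

text \<open>A sender supplies \<open>N\<close> because the current round is not yet in its history.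
  For \<open>out\<close> it is, and the dummy \<open>{}\<close> lies beyond the indices
  read.\<close>

definition nbr_log :: "nat \<Rightarrow> nat ugraph \<Rightarrow> observation list \<Rightarrow> nat set \<Rightarrow> nat \<Rightarrow> nat set" where
  "nbr_log v G0 h N j = (nbrs G0 v # map fst h @ [N]) ! j"

text \<open>The disjuncts are: a shared recent age; the age of the edge to \<open>x\<close>, relayed
  by \<open>y\<close> in the first round in which \<open>y\<close> is heard; the identifier of
  \<open>y\<close> spelled out by \<open>x\<close> at a fixed position \<open>p\<close> during
  \<open>L\<close> consecutive rounds, which cover all bit positions.\<close>

definition evidence ::
    "nat \<Rightarrow> (nat \<Rightarrow> nat set) \<Rightarrow> (nat \<Rightarrow> nat \<Rightarrow> nat list) \<Rightarrow> nat \<Rightarrow> nat \<Rightarrow> nat \<Rightarrow> bool" where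
  "evidence L M m t x y \<longleftrightarrow>
     (\<exists>k<t. \<exists>a<L. a \<in> set (m k x) \<and> a \<in> set (m k y)) \<or>
     (\<exists>k<t. \<exists>j<k. y \<notin> M k \<and> x \<notin> M j \<and> x \<in> M (Suc j) \<and> k - j \<le> L \<and> L + (k - j) \<in> set (m k y)) \<or>
     (\<exists>k p. k + L \<le> t \<and> (\<forall>i\<in>{k..<k + L}. p < length (filter ((<) (2 * L)) (m i x)) \<and>
        filter ((<) (2 * L)) (m i x) ! p = 2 * L + 1 + of_bool (bit y (i mod L))))"

text \<open>In \<open>send\<close> the history ends with the previous round, so
  \<open>length h\<close> is the index of the current one. The graph rebuilt in \<open>out\<close>
  is only meant to be right at \<open>v\<close> and between neighbours of \<open>v\<close>.\<close>

definition triangle_algorithm :: algorithm where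
  "triangle_algorithm = \<lparr>
     send = (\<lambda>v G0 h N u.
       let n = card (verts G0); L = id_bits n; W = code_bits n in
       encode W (signal L (nbr_log v G0 h N)
         (if h = [] then []
          else relayed L (\<lambda>y. set (decode W (snd (last h) y))) (fst (last h))) (length h))),
     out = (\<lambda>v G0 h.
       let n = card (verts G0); L = id_bits n; W = code_bits n; N = fst (last h);
           M = nbr_log v G0 h {}; m = (\<lambda>k x. decode W (snd (h ! k) x)) in
       mem_list (complete_graph 3)
         \<lparr>verts = verts G0,
          edges = (\<lambda>x. {x, v}) ` N \<union>
            {{x, y} | x y. x \<in> N \<and> y \<in> N \<and> x \<noteq> y \<and> ({x, y} \<in> edges G0 \<or>
               evidence L M m (length h) x y \<or> evidence L M m (length h) y x)}\<rparr> v)\<rparr>"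

section \<open>Lengths and recovery of the parts of a signal\<close>

lemma arrivals_Suc:
  "arrivals M (Suc k) = arrivals M k @ sorted_list_of_set (M (Suc (Suc k)) - M (Suc k))"
  by (simp add: arrivals_def)

lemma set_arrivals:
  assumes "mono M" "\<And>j. finite (M j)"
  shows "set (arrivals M k) = M (Suc k) - M 0"
proof (induction k)
  case 0
  then show ?case using assms by (simp add: arrivals_def)
next
  case (Suc k)
  have "M 0 \<subseteq> M (Suc k)" "M (Suc k) \<subseteq> M (Suc (Suc k))"
    using assms(1) by (simp_all add: monoD)
  then show ?case using Suc assms by (auto simp: arrivals_Suc)
qed

text \<open>The increments of \<open>M\<close> telescope to an equality once the initial neighbours
  are added.\<close>

lemma length_arrivals_le:
  assumes "mono M" "\<And>j. finite (M j)"
  shows "length (arrivals M k) \<le> card (M (Suc k))"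
proof -
  have "length (arrivals M k) + card (M 0) = card (M (Suc k))"
  proof (induction k)
    case 0
    have "M 0 \<subseteq> M (Suc 0)"
      using assms(1) by (simp add: monoD)
    then show ?case
      using assms(2) by (simp add: arrivals_def card_Diff_subset card_mono)
  next
    case (Suc k)
    have "M (Suc k) \<subseteq> M (Suc (Suc k))"
      using assms(1) by (simp_all add: monoD)
    then have "card (M (Suc (Suc k)) - M (Suc k)) + card (M (Suc k)) = card (M (Suc (Suc k)))"
      using assms(2) by (simp add: card_Diff_subset card_mono)
    then show ?case using Suc by (simp add: arrivals_Suc)
  qed
  then show ?thesis by simp
qed

text \<open>Later arrivals are only appended, so positions are permanent.\<close>

lemma arrivals_nth:
  assumes "i \<le> k" "p < length (arrivals M i)"
  shows "p < length (arrivals M k)" "arrivals M k ! p = arrivals M i ! p"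
proof -
  obtain d where "k = i + d"
    using assms(1) le_Suc_ex by blast
  moreover have "\<exists>ys. arrivals M (i + d) = arrivals M i @ ys"
    by (induction d) (auto simp: arrivals_Suc)
  ultimately show "p < length (arrivals M k)" "arrivals M k ! p = arrivals M i ! p"
    using assms(2) by (auto simp: nth_append)
qed

text \<open>Each age is mapped to a neighbour gained in its round; as \<open>M\<close> grows, these
  neighbours are distinct.\<close>

lemma length_ages_le:
  assumes "mono M" "\<And>j. finite (M j)"
  shows "length (ages L M k) \<le> card (M (Suc k))"
proof -
  have sub: "M i \<subseteq> M j" if "i \<le> j" for i j
    using assms(1) that by (simp add: monoD)
  have "\<forall>a\<in>set (ages L M k). \<exists>z. z \<in> M (Suc (k - a)) - M (k - a)"
    using sub[of "k - a" "Suc (k - a)" for a] by (fastforce simp: ages_def)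
  then obtain f where f: "\<And>a. a \<in> set (ages L M k) \<Longrightarrow> f a \<in> M (Suc (k - a)) - M (k - a)"
    by metis
  have "f a \<noteq> f b" if "a \<in> set (ages L M k)" "b \<in> set (ages L M k)" "a < b" for a b
  proof -
    have "M (Suc (k - b)) \<subseteq> M (k - a)"
      using that by (intro sub) (auto simp: ages_def)
    then show ?thesis using f[OF that(1)] f[OF that(2)] by auto
  qed
  then have "inj_on f (set (ages L M k))"
    by (metis inj_onI linorder_neqE_nat)
  moreover have "f a \<in> M (Suc k)" if "a \<in> set (ages L M k)" for a
    using f[OF that] sub[of "Suc (k - a)" "Suc k"] by auto
  ultimately have "card (set (ages L M k)) \<le> card (M (Suc k))"
    using assms(2) by (intro card_inj_on_le[of f]) auto
  moreover have "distinct (ages L M k)"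
    by (simp add: ages_def)
  ultimately show ?thesis
    by (metis distinct_card)
qed

text \<open>A union bound; this product is the source of the quadratic factor in the
  bandwidth.\<close>

lemma length_relayed_le:
  assumes "finite N" "\<And>y. y \<in> N \<Longrightarrow> finite (R y) \<and> card (R y) \<le> D"
  shows "length (relayed L R N) \<le> card N * D"
proof -
  have "length (relayed L R N) = card (set (relayed L R N))"
    unfolding relayed_def by (intro distinct_card[symmetric] distinct_filter distinct_upt)
  also have "\<dots> \<le> card (\<Union>y\<in>N. Suc ` R y)"
  proof (intro card_mono finite_UN_I finite_imageI subsetI)
    fix a assume "a \<in> set (relayed L R N)"
    then obtain y where "y \<in> N" "a - 1 \<in> R y" "a \<ge> 1"
      by (auto simp: relayed_def)
    then show "a \<in> (\<Union>y\<in>N. Suc ` R y)"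
      by (auto intro!: bexI[of _ y] image_eqI[of _ _ "a - 1"])
  qed (use assms in auto)
  also have "\<dots> \<le> (\<Sum>y\<in>N. card (Suc ` R y))"
    by (rule card_UN_le[OF assms(1)])
  also have "\<dots> \<le> (\<Sum>y\<in>N. D)"
    using assms(2) by (intro sum_mono) (simp add: card_image)
  finally show ?thesis by simp
qed

text \<open>The kinds of codes occupy disjoint ranges, and filtering preserves order, so positions
  in \<open>arrivals\<close> survive.\<close>

lemma filter_signal:
  assumes "set as \<subseteq> {1..L}"
  shows "filter ((<) (2 * L)) (signal L M as k) =
    map (\<lambda>y. 2 * L + 1 + of_bool (bit y (k mod L))) (arrivals M k)"
proof -
  have "filter ((<) (2 * L)) (ages L M k) = []" "filter ((<) (2 * L)) (map ((+) L) as) = []"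
    using assms by (auto simp: filter_empty_conv ages_def)
  then show ?thesis
    by (auto simp: signal_def filter_map o_def)
qed

lemma in_signal_own_iff:
  assumes "a < L"
  shows "a \<in> set (signal L M as k) \<longleftrightarrow> a \<in> set (ages L M k)"
  using assms by (auto simp: signal_def)

lemma in_signal_relayed_iff:
  assumes "1 \<le> a" "a \<le> L"
  shows "L + a \<in> set (signal L M as k) \<longleftrightarrow> a \<in> set as"
  using assms by (auto simp: signal_def ages_def)

lemma signal_cong:
  assumes "\<And>j. j \<le> Suc k \<Longrightarrow> M j = M' j"
  shows "signal L M as k = signal L M' as k"
proof -
  have "ages L M k = ages L M' k"
    using assms by (auto simp: ages_def intro!: filter_cong)
  moreover have "arrivals M k = arrivals M' k"
    using assms unfolding arrivals_def by (intro arg_cong[of _ _ concat] map_cong) auto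
  ultimately show ?thesis by (simp add: signal_def)
qed

lemma evidence_cong:
  assumes M: "\<And>j. j \<le> t \<Longrightarrow> M j = M' j" and m: "\<And>k. k < t \<Longrightarrow> m k = m' k"
  shows "evidence l M m t x y = evidence l M' m' t x y"
  unfolding evidence_def
  by (intro arg_cong2[of _ _ _ _ "(\<or>)"] ex_cong1 conj_cong ball_cong refl) (simp_all add: M m)

section \<open>Correctness and bandwidth\<close>

lemma nbrs_sym: "x \<in> nbrs G y \<longleftrightarrow> y \<in> nbrs G x"
  by (simp add: nbrs_def insert_commute)

lemma history_eq:
  "history A G i v = map (\<lambda>k. (nbrs (G (Suc k)) v,
     \<lambda>u. if u \<in> nbrs (G (Suc k)) v then sent A G k u v else [])) [0..<i]"
  by (induction i) (simp_all add: sent_def cong: if_cong)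

section \<open>Growing networks and insertion times\<close>

locale network =
  fixes n :: nat and G :: "nat \<Rightarrow> nat ugraph"
  assumes dynamic: "dynamic_network n G"
begin

abbreviation nbrs_at :: "nat \<Rightarrow> nat \<Rightarrow> nat set" where
  "nbrs_at v j \<equiv> nbrs (G j) v"

lemma step: "G (Suc i) = G i \<or> edge_insertion (G i) (G (Suc i))"
  using dynamic by (simp add: dynamic_network_def)

lemma simple_graph_G: "simple_graph (G i) \<and> verts (G i) = {1..n}"
proof (induction i)
  case 0
  then show ?case using dynamic by (simp add: dynamic_network_def)
next
  case (Suc i)
  have "simple_graph (G (Suc i)) \<and> verts (G (Suc i)) = verts (G i)"
    using step[of i] Suc[THEN conjunct1] unfolding simple_graph_def edge_insertion_def
    by (elim disjE bexE conjE) simp_all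
  then show ?case using Suc by simp
qed

lemma edges_mono: "i \<le> j \<Longrightarrow> edges (G i) \<subseteq> edges (G j)"
proof (induction rule: dec_induct)
  case (step k)
  then show ?case using network.step[OF network_axioms, of k] by (auto simp: edge_insertion_def)
qed simp

lemma nbrs_at_mono: "mono (nbrs_at v)"
  using edges_mono by (intro monoI) (auto simp: nbrs_def)

lemma nbrs_at_subset: "nbrs_at v i \<subseteq> {1..n}"
  using simple_graph_G[of i] by (auto simp: nbrs_def simple_graph_def)

lemma not_self_nbr: "v \<notin> nbrs_at v i"
  using simple_graph_G[of i] by (auto simp: nbrs_def simple_graph_def)

lemma finite_nbrs_at: "finite (nbrs_at v i)"
  using nbrs_at_subset finite_subset by blast

lemma card_nbrs_at_le: "v \<in> {1..n} \<Longrightarrow> card (nbrs_at v i) \<le> max_degree G"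
  unfolding max_degree_def
proof (rule cSup_upper)
  \<comment> \<open>\<open>Sup\<close> on \<open>nat\<close> is an upper bound only for bounded
    sets; \<open>n\<close> bounds all degrees.\<close>
  show "bdd_above {card (nbrs_at v i) | i v. v \<in> verts (G i)}"
    using card_mono[OF _ nbrs_at_subset] by (intro bdd_aboveI[of _ n]) fastforce
qed (use simple_graph_G in auto)

text \<open>This is what makes ages usable as names of edges.\<close>

lemma new_edge_unique:
  assumes "e \<in> edges (G (Suc j)) - edges (G j)" "e' \<in> edges (G (Suc j)) - edges (G j)"
  shows "e = e'"
  using assms step[of j] by (auto simp: edge_insertion_def)

lemma insertion_time:
  assumes "e \<in> edges (G i)" "e \<notin> edges (G 0)"
  obtains j where "j < i" "e \<notin> edges (G j)" "e \<in> edges (G (Suc j))"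
  using assms by (induction i) (auto simp: less_Suc_eq)

lemma ages_nbrs_iff:
  "a \<in> set (ages L (nbrs_at x) k) \<longleftrightarrow>
    a < L \<and> a \<le> k \<and> (\<exists>z. {z, x} \<in> edges (G (Suc (k - a))) - edges (G (k - a)))"
proof -
  have "nbrs_at x j \<noteq> nbrs_at x (Suc j) \<longleftrightarrow>
      (\<exists>z. {z, x} \<in> edges (G (Suc j)) - edges (G j))" for j
    using edges_mono[of j "Suc j"] by (auto simp: nbrs_def)
  then show ?thesis by (simp add: ages_def)
qed

section \<open>Messages of a run and their length\<close>

definition L :: nat where
  "L = id_bits n"

definition W :: nat where
  "W = code_bits n"

text \<open>Computed from the network instead of from messages. Index \<open>k\<close> of the
  neighbourhood is the graph in which the preceding messages, of index \<open>k - 1\<close>,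
  travelled.\<close>

definition relay :: "nat \<Rightarrow> nat \<Rightarrow> nat list" where
  "relay u k = (if k = 0 then [] else
     relayed L (\<lambda>y. set (ages L (nbrs_at y) (k - 1))) (nbrs_at u k))"

abbreviation node_signal :: "nat \<Rightarrow> nat \<Rightarrow> nat list" where
  "node_signal u k \<equiv> signal L (nbrs_at u) (relay u k) k"

lemma set_relay: "set (relay u k) \<subseteq> {1..L}"
  by (auto simp: relay_def relayed_def)

lemma L_pos: "L > 0"
  by (simp add: L_def id_bits_def)

lemma id_less: "x \<in> {1..n} \<Longrightarrow> x < 2 ^ L"
  using less_exp_Suc_floor_log[of n] by (auto simp: L_def id_bits_def)

lemma decode_encode_signal:
  "decode W (encode W (node_signal u k)) = node_signal u k"
proof (rule decode_encode)
  show "W > 0" by (simp add: W_def code_bits_def)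
  have "2 * L + 3 < 2 ^ W"
    using less_exp_Suc_floor_log[of "2 * L + 3"] by (simp add: W_def L_def code_bits_def)
  then show "set (node_signal u k) \<subseteq> {..<2 ^ W}"
    using set_relay[of u k] by (fastforce simp: signal_def ages_def of_bool_def)
qed

text \<open>Nodes that are not neighbours deliver the empty message.\<close>

lemma decode_Nil: "decode W [] = []"
  using decode_encode[of W "[]"] by (simp add: W_def code_bits_def encode_def)

lemma nbr_log_history:
  assumes "j \<le> k \<or> j = Suc k \<and> N = nbrs_at v j"
  shows "nbr_log v (G 0) (history A G k v) N j = nbrs_at v j"
  using assms by (cases j) (auto simp: nbr_log_def history_eq nth_append o_def)

text \<open>Induction over rounds: what is relayed in a round is decoded from the messages of the
  previous one.\<close>

lemma sent_eq: "sent triangle_algorithm G k u v = encode W (node_signal u k)"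
proof (induction k arbitrary: u v)
  case (0 u v)
  have "signal L (nbr_log u (G 0) [] (nbrs_at u (Suc 0))) [] 0 = signal L (nbrs_at u) [] 0"
    using nbr_log_history[of _ 0 _ u] by (intro signal_cong) (auto simp: le_Suc_eq)
  then show ?case
    using simple_graph_G[of 0]
    by (simp add: sent_def triangle_algorithm_def L_def W_def relay_def)
next
  case (Suc k u v)
  let ?h = "history triangle_algorithm G (Suc k) u"
  have last: "last ?h = (nbrs_at u (Suc k),
      \<lambda>y. if y \<in> nbrs_at u (Suc k) then sent triangle_algorithm G k y u else [])"
    by (simp add: history_eq del: history.simps)
  \<comment> \<open>Only the senders' own ages, with codes below \<open>L\<close>, are passed on;
    relayed ages travel no further.\<close>
  have "a - 1 \<in> set (decode W (snd (last ?h) y)) \<longleftrightarrow> a - 1 \<in> set (ages L (nbrs_at y) k)"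
    if "a \<in> set [1..<Suc L]" "y \<in> nbrs_at u (Suc k)" for a y
  proof -
    have "a - 1 < L" using that by (auto simp del: upt_Suc)
    then show ?thesis
      unfolding last using that by (simp add: Suc.IH decode_encode_signal in_signal_own_iff)
  qed
  then have "relayed L (\<lambda>y. set (decode W (snd (last ?h) y))) (fst (last ?h)) = relay u (Suc k)"
    unfolding relay_def relayed_def by (auto simp: last simp del: upt_Suc history.simps intro!: filter_cong)
  moreover have "signal L (nbr_log u (G 0) ?h (nbrs_at u (Suc (Suc k)))) as (Suc k) =
      signal L (nbrs_at u) as (Suc k)" for as
    using nbr_log_history[of _ "Suc k" _ u] by (intro signal_cong) (auto simp: le_Suc_eq)
  moreover have "length ?h = Suc k" "?h \<noteq> []"
    by (simp_all add: history_eq del: history.simps)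
  ultimately show ?case
    using simple_graph_G[of 0]
    by (simp add: sent_def triangle_algorithm_def L_def W_def del: history.simps)
qed

lemma bandwidth:
  "respects_bandwidth triangle_algorithm G (W * (3 * (max_degree G)\<^sup>2))"
  unfolding respects_bandwidth_def
proof (intro allI ballI)
  fix i u v
  assume "u \<in> verts (G (Suc i))" and v: "v \<in> nbrs_at u (Suc i)"
  then have u: "u \<in> {1..n}" using simple_graph_G by simp
  define D where "D = max_degree G"
  have D: "card (nbrs_at x j) \<le> D" if "x \<in> {1..n}" for x j
    using card_nbrs_at_le[OF that] by (simp add: D_def)
  \<comment> \<open>A recipient exists, so \<open>D\<close> is positive and the two linear parts of
    a signal also fit into \<open>D * D\<close>.\<close>
  have "card (nbrs_at u (Suc i)) > 0"
    using v finite_nbrs_at by (auto simp: card_gt_0_iff)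
  then have "D \<ge> 1" using D[OF u, of "Suc i"] by simp
  have ages: "length (ages L (nbrs_at x) k) \<le> D" if "x \<in> {1..n}" for x k
    using length_ages_le[OF nbrs_at_mono finite_nbrs_at] D[OF that] le_trans by blast
  have "length (relay u i) \<le> D * D"
  proof (cases "i = 0")
    case False
    have "length (relay u i) \<le> card (nbrs_at u i) * D"
      unfolding relay_def using False
      by (auto intro!: length_relayed_le finite_nbrs_at le_trans[OF card_length ages]
          subsetD[OF nbrs_at_subset])
    then show ?thesis using D[OF u, of i] mult_le_mono1 le_trans by blast
  qed (simp add: relay_def)
  moreover have "length (arrivals (nbrs_at u) i) \<le> D"
    using length_arrivals_le[OF nbrs_at_mono finite_nbrs_at] D[OF u] le_trans by blast
  moreover have "D \<le> D * D" using \<open>D \<ge> 1\<close> by simp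
  moreover have "length (node_signal u i) =
      length (ages L (nbrs_at u) i) + length (relay u i) + length (arrivals (nbrs_at u) i)"
    by (simp add: signal_def)
  ultimately have "length (node_signal u i) \<le> 3 * D\<^sup>2"
    using ages[OF u, of i] unfolding power2_eq_square by linarith
  then show "length (sent triangle_algorithm G i u v) \<le> W * (3 * (max_degree G)\<^sup>2)"
    by (simp add: sent_eq length_encode D_def)
qed

section \<open>Soundness and completeness of the evidence\<close>

definition received :: "nat \<Rightarrow> nat \<Rightarrow> nat \<Rightarrow> nat list" where
  "received w k x = (if x \<in> nbrs_at w (Suc k) then node_signal x k else [])"

lemma in_received_iff:
  "a \<in> set (received w k x) \<longleftrightarrow> x \<in> nbrs_at w (Suc k) \<and> a \<in> set (node_signal x k)"
  by (cases "x \<in> nbrs_at w (Suc k)") (simp_all add: received_def)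

lemma evidence_sound:
  assumes ev: "evidence L (nbrs_at w) (received w) t x y"
    and "x \<noteq> y" "y \<in> {1..n}"
  shows "{x, y} \<in> edges (G t)"
  using ev unfolding evidence_def
proof (elim disjE exE conjE)
  fix k a
  assume k: "k < t" "a < L" "a \<in> set (received w k x)" "a \<in> set (received w k y)"
  then have "a \<in> set (ages L (nbrs_at x) k)" "a \<in> set (ages L (nbrs_at y) k)"
    by (auto simp: in_received_iff in_signal_own_iff)
  then obtain z z' where "{z, x} \<in> edges (G (Suc (k - a))) - edges (G (k - a))"
    "{z', y} \<in> edges (G (Suc (k - a))) - edges (G (k - a))"
    by (auto simp: ages_nbrs_iff)
  \<comment> \<open>Equal ages in one round name the same edge; as \<open>x \<noteq> y\<close>, its
    ends are \<open>x\<close> and \<open>y\<close>.\<close>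
  moreover from this have "{z, x} = {z', y}"
    by (rule new_edge_unique)
  ultimately have "{x, y} \<in> edges (G (Suc (k - a)))"
    using \<open>x \<noteq> y\<close> by (auto simp: doubleton_eq_iff insert_commute)
  moreover have "Suc (k - a) \<le> t" using k by simp
  ultimately show ?thesis using edges_mono by blast
next
  fix k j
  assume k: "k < t" "j < k" "y \<notin> nbrs_at w k" "x \<notin> nbrs_at w j" "x \<in> nbrs_at w (Suc j)"
    "k - j \<le> L" "L + (k - j) \<in> set (received w k y)"
  then have "k - j \<in> set (relay y k)"
    unfolding in_received_iff by (subst (asm) in_signal_relayed_iff) simp_all
  then obtain z where z: "z \<in> nbrs_at y k" "k - j - 1 \<in> set (ages L (nbrs_at z) (k - 1))"
    by (auto simp: relay_def relayed_def split: if_splits)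
  moreover have "k - 1 - (k - j - 1) = j" using k by simp
  ultimately obtain z' where "{z', z} \<in> edges (G (Suc j)) - edges (G j)"
    by (metis ages_nbrs_iff)
  moreover have "{x, w} \<in> edges (G (Suc j)) - edges (G j)"
    using k by (auto simp: nbrs_def)
  ultimately have "{z', z} = {x, w}"
    by (rule new_edge_unique)
  \<comment> \<open>\<open>z\<close> is adjacent to \<open>y\<close>, but \<open>w\<close> is not
    yet, so the edge \<open>xw\<close> was reported by its end \<open>x\<close>.\<close>
  moreover have "z \<noteq> w" using z k nbrs_sym by metis
  ultimately have "z = x" by (auto simp: doubleton_eq_iff)
  then show ?thesis
    using z edges_mono[of k t] k by (auto simp: nbrs_def)
next
  fix k p
  assume k: "k + L \<le> t" and *: "\<forall>i\<in>{k..<k + L}.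
     p < length (filter ((<) (2 * L)) (received w i x)) \<and>
     filter ((<) (2 * L)) (received w i x) ! p = 2 * L + 1 + of_bool (bit y (i mod L))"
  have **: "p < length (arrivals (nbrs_at x) i) \<and>
      bit (arrivals (nbrs_at x) i ! p) (i mod L) = bit y (i mod L)" if "i \<in> {k..<k + L}" for i
  proof -
    have "received w i x \<noteq> []" using * that by force
    then have "received w i x = node_signal x i"
      by (simp add: received_def split: if_splits)
    then show ?thesis
      using bspec[OF * that] by (auto simp: filter_signal[OF set_relay] of_bool_def split: if_splits)
  qed
  \<comment> \<open>As positions are permanent, all bits at position \<open>p\<close> belong to this
    one node.\<close>
  define z where "z = arrivals (nbrs_at x) k ! p"
  have p: "p < length (arrivals (nbrs_at x) k)"
    using **[of k] L_pos by simp
  then have "z \<in> nbrs_at x (Suc k)"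
    using nth_mem[OF p] set_arrivals[OF nbrs_at_mono finite_nbrs_at] by (simp add: z_def)
  have "z = y"
  proof (rule eq_if_bits_eq)
    show "z < 2 ^ L" "y < 2 ^ L"
      using id_less \<open>y \<in> {1..n}\<close> \<open>z \<in> nbrs_at x (Suc k)\<close> nbrs_at_subset by blast+
    fix b assume "b < L"
    \<comment> \<open>The index in the window at which bit \<open>b\<close> is sent.\<close>
    define i where "i = k + (b + L - k mod L) mod L"
    have "i \<in> {k..<k + L}" using L_pos by (simp add: i_def)
    have "i mod L = (k mod L + (b + L - k mod L)) mod L"
      by (simp add: i_def mod_simps)
    also have "k mod L + (b + L - k mod L) = b + L"
      using mod_less_divisor[OF L_pos, of k] by simp
    also have "(b + L) mod L = b"
      using \<open>b < L\<close> by simp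
    finally have "i mod L = b" .
    moreover have "arrivals (nbrs_at x) i ! p = z"
      using arrivals_nth(2)[OF _ p, of i] \<open>i \<in> _\<close> by (simp add: z_def)
    ultimately show "bit z b = bit y b"
      using **[OF \<open>i \<in> _\<close>] by simp
  qed
  then show ?thesis
    using \<open>z \<in> nbrs_at x (Suc k)\<close> edges_mono[of "Suc k" t] k L_pos
    by (auto simp: nbrs_def insert_commute)
qed

lemma in_nbrs_at: "x \<in> nbrs_at w j \<Longrightarrow> j \<le> k \<Longrightarrow> x \<in> nbrs_at w k"
  using monoD[OF nbrs_at_mono] by blast

text \<open>By \<open>order\<close>, \<open>x\<close> becomes adjacent to \<open>w\<close> no later
  than \<open>y\<close>. In the proof, \<open>a\<close>, \<open>c\<close> and \<open>b\<close> are
  the last indices before the insertions of \<open>xy\<close>, \<open>yw\<close> and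
  \<open>xw\<close>.\<close>

lemma evidence_complete:
  assumes "x \<in> nbrs_at w t" "y \<in> nbrs_at w t" "{x, y} \<in> edges (G t)" "{x, y} \<notin> edges (G 0)"
    and order: "\<And>j. x \<in> nbrs_at w j \<or> y \<notin> nbrs_at w j"
  shows "evidence L (nbrs_at w) (received w) t x y"
proof -
  obtain a where a: "a < t" "{x, y} \<notin> edges (G a)" "{x, y} \<in> edges (G (Suc a))"
    using insertion_time assms by metis
  have common_age: "evidence L (nbrs_at w) (received w) t x y"
    if "k < t" "a \<le> k" "k - a < L" "x \<in> nbrs_at w (Suc k)" "y \<in> nbrs_at w (Suc k)" for k
  proof -
    have "k - a \<in> set (ages L (nbrs_at x) k)" "k - a \<in> set (ages L (nbrs_at y) k)"
      using a that by (auto simp: ages_nbrs_iff insert_commute)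
    then have "k - a \<in> set (received w k x)" "k - a \<in> set (received w k y)"
      using that by (simp_all add: in_received_iff in_signal_own_iff)
    then show ?thesis
      unfolding evidence_def using that by blast
  qed
  show ?thesis
  proof (cases "y \<in> nbrs_at w (Suc a)")
    case True
    then show ?thesis
      using common_age[of a] a order[of "Suc a"] L_pos by auto
  next
    case False
    then have "y \<notin> nbrs_at w 0"
      using in_nbrs_at by blast
    then obtain c where c: "c < t" "y \<notin> nbrs_at w c" "y \<in> nbrs_at w (Suc c)"
      using insertion_time[of "{y, w}" t] assms(2) by (auto simp: nbrs_def)
    have "a < c"
      using False c in_nbrs_at[of y "Suc c" w "Suc a"] by force
    have x: "x \<in> nbrs_at w (Suc c)"
      using order c by blast
    \<comment> \<open>The round that inserts \<open>yw\<close> cannot also insert \<open>xw\<close>,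
      so \<open>x\<close> was adjacent to \<open>w\<close> already.\<close>
    have "{x, w} \<noteq> {y, w}"
      using assms(3) simple_graph_G[of t] by (auto simp: simple_graph_def doubleton_eq_iff)
    then have xc: "x \<in> nbrs_at w c"
      using x c new_edge_unique[of "{x, w}" c "{y, w}"] by (auto simp: nbrs_def)
    show ?thesis
    proof (cases "c - a < L")
      case True
      then show ?thesis
        using common_age[of c] c x \<open>a < c\<close> by simp
    next
      case far: False
      show ?thesis
      proof (cases "x \<in> nbrs_at w (c - L)")
        case True
        \<comment> \<open>From index \<open>c - L\<close> to \<open>c - 1\<close>, \<open>x\<close>
          is adjacent to both \<open>w\<close> and \<open>y\<close>, which is time enough to spell
          out \<open>y\<close>.\<close>
        have "y \<in> set (arrivals (nbrs_at x) (c - L))"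
          using far a assms(4) in_nbrs_at[of y "Suc a" x "Suc (c - L)"] \<open>a < c\<close>
          unfolding set_arrivals[OF nbrs_at_mono finite_nbrs_at]
          by (auto simp: nbrs_def insert_commute)
        then obtain p where p: "p < length (arrivals (nbrs_at x) (c - L))"
          "arrivals (nbrs_at x) (c - L) ! p = y"
          by (auto simp: in_set_conv_nth)
        have "p < length (filter ((<) (2 * L)) (received w i x)) \<and>
            filter ((<) (2 * L)) (received w i x) ! p = 2 * L + 1 + of_bool (bit y (i mod L))"
          if "i \<in> {c - L..<c - L + L}" for i
        proof -
          have "x \<in> nbrs_at w (Suc i)"
            using in_nbrs_at[OF True, of "Suc i"] that by simp
          then show ?thesis
            using arrivals_nth[OF _ p(1), of i] p(2) that
            by (simp add: received_def filter_signal[OF set_relay])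
        qed
        then show ?thesis
          unfolding evidence_def using far c
          by (intro disjI2 exI[of _ "c - L"] exI[of _ p]) auto
      next
        case False
        \<comment> \<open>At index \<open>c - 1\<close>, \<open>y\<close> hears the age
          \<open>c - 1 - b\<close> of \<open>xw\<close> from \<open>x\<close>; it relays it at index
          \<open>c\<close>, when \<open>w\<close> first hears \<open>y\<close>. The relayed age may
          equal \<open>L\<close>.\<close>
        obtain b where b: "b < c" "x \<notin> nbrs_at w b" "x \<in> nbrs_at w (Suc b)"
          using insertion_time[of "{x, w}" c] xc False in_nbrs_at[of x 0 w "c - L"]
          by (auto simp: nbrs_def)
        have "c - L \<le> b"
          using False b in_nbrs_at[of x "Suc b" w "c - L"] by force
        have "{x, w} \<in> edges (G (Suc b)) - edges (G b)"
          using b by (simp add: nbrs_def)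
        moreover have "c - 1 - (c - b - 1) = b" using b by simp
        ultimately have "c - b - 1 \<in> set (ages L (nbrs_at x) (c - 1))"
          using b \<open>c - L \<le> b\<close> far unfolding ages_nbrs_iff
          by (auto simp: insert_commute intro!: exI[of _ w])
        moreover have "x \<in> nbrs_at y c"
          using a \<open>a < c\<close> in_nbrs_at[of x "Suc a" y c] by (auto simp: nbrs_def)
        ultimately have "c - b \<in> set (relay y c)"
          using b \<open>c - L \<le> b\<close> far by (auto simp: relay_def relayed_def)
        moreover have "1 \<le> c - b" "c - b \<le> L"
          using b \<open>c - L \<le> b\<close> by simp_all
        ultimately have "L + (c - b) \<in> set (received w c y)"
          using c unfolding in_received_iff by (subst in_signal_relayed_iff) simp_all
        then show ?thesis
          unfolding evidence_def using b c \<open>c - L \<le> b\<close> far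
          by (intro disjI2 disjI1 exI[of _ c] conjI exI[of _ b]) auto
      qed
    qed
  qed
qed

lemma evidence_iff:
  assumes "x \<in> nbrs_at w t" "y \<in> nbrs_at w t" "x \<noteq> y"
  shows "{x, y} \<in> edges (G t) \<longleftrightarrow> {x, y} \<in> edges (G 0) \<or>
    evidence L (nbrs_at w) (received w) t x y \<or> evidence L (nbrs_at w) (received w) t y x"
    (is "?E \<longleftrightarrow> ?init \<or> ?xy \<or> ?yx")
proof
  assume ?E
  \<comment> \<open>Neighbourhoods of \<open>w\<close> only grow, so the arrivals of
    \<open>x\<close> and \<open>y\<close> are comparable.\<close>
  have "(\<forall>j. x \<in> nbrs_at w j \<or> y \<notin> nbrs_at w j) \<or> (\<forall>j. y \<in> nbrs_at w j \<or> x \<notin> nbrs_at w j)"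
    by (metis in_nbrs_at nle_le)
  then show "?init \<or> ?xy \<or> ?yx"
  proof
    assume "\<forall>j. x \<in> nbrs_at w j \<or> y \<notin> nbrs_at w j"
    then show ?thesis
      using evidence_complete[OF assms(1,2) \<open>?E\<close>] by blast
  next
    assume "\<forall>j. y \<in> nbrs_at w j \<or> x \<notin> nbrs_at w j"
    then show ?thesis
      using evidence_complete[OF assms(2,1)] \<open>?E\<close> by (metis insert_commute)
  qed
next
  have ids: "x \<in> {1..n}" "y \<in> {1..n}"
    using assms nbrs_at_subset by blast+
  assume "?init \<or> ?xy \<or> ?yx"
  then show ?E
  proof (elim disjE)
    assume ?init
    then show ?E using edges_mono[of 0 t] by blast
  next
    assume ?xy
    then show ?E using assms(3) ids(2) by (rule evidence_sound)
  next
    assume ?yx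
    then have "{y, x} \<in> edges (G t)"
      using assms(3)[symmetric] ids(1) by (rule evidence_sound)
    then show ?E by (simp add: insert_commute)
  qed
qed

text \<open>By \<open>evidence_iff\<close>, the rebuilt graph \<open>H\<close> agrees with
  \<open>G i\<close> at \<open>v\<close> and between neighbours of \<open>v\<close>, which suffices
  for cliques through \<open>v\<close>.\<close>

lemma correct: "one_round_MemList (complete_graph 3) triangle_algorithm G"
  unfolding one_round_MemList_def
proof (intro allI impI ballI)
  fix i v :: nat
  assume "i \<ge> 1"
  let ?h = "history triangle_algorithm G i v"
  let ?adj = "\<lambda>x y. {x, y} \<in> edges (G 0) \<or> evidence L (nbrs_at v) (received v) i x y \<or>
    evidence L (nbrs_at v) (received v) i y x"
  define H where "H = \<lparr>verts = verts (G 0), edges = (\<lambda>x. {x, v}) ` nbrs_at v i \<union>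
    {{x, y} | x y. x \<in> nbrs_at v i \<and> y \<in> nbrs_at v i \<and> x \<noteq> y \<and> ?adj x y}\<rparr>"
  have "fst (last ?h) = nbrs_at v i" "length ?h = i"
    using \<open>i \<ge> 1\<close> by (simp_all add: history_eq last_map)
  moreover have "evidence L (nbr_log v (G 0) ?h {}) (\<lambda>k x. decode W (snd (?h ! k) x)) i x y =
      evidence L (nbrs_at v) (received v) i x y" for x y
  proof (intro evidence_cong ext)
    fix k x assume "k < i"
    then show "decode W (snd (?h ! k) x) = received v k x"
      by (simp add: history_eq received_def sent_eq decode_encode_signal decode_Nil)
  qed (simp add: nbr_log_history)
  ultimately have "out triangle_algorithm v (G 0) ?h = mem_list (complete_graph 3) H v"
    using simple_graph_G[of 0]
    by (simp add: triangle_algorithm_def H_def L_def W_def Let_def)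
  also have "\<dots> = mem_list (complete_graph 3) (G i) v"
  proof (rule mem_list_complete_graph_cong)
    show "verts H = verts (G i)"
      using simple_graph_G by (simp add: H_def)
    have star: "{x, v} \<in> edges H \<longleftrightarrow> x \<in> nbrs_at v i" for x
      using not_self_nbr[of v i] by (auto simp: H_def doubleton_eq_iff)
    then show "{x, v} \<in> edges H \<longleftrightarrow> {x, v} \<in> edges (G i)" for x
      by (simp add: nbrs_def)
    fix x y assume "{x, v} \<in> edges H" "{y, v} \<in> edges H" "x \<noteq> y"
    then have xy: "x \<in> nbrs_at v i" "y \<in> nbrs_at v i"
      by (simp_all add: star)
    then have "{x, y} \<in> edges H \<longleftrightarrow> ?adj x y"
      using not_self_nbr[of v i] \<open>x \<noteq> y\<close> by (auto simp: H_def doubleton_eq_iff insert_commute)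
    then show "{x, y} \<in> edges H \<longleftrightarrow> {x, y} \<in> edges (G i)"
      using evidence_iff[OF xy \<open>x \<noteq> y\<close>] by simp
  qed
  finally show "out triangle_algorithm v (G 0) ?h = mem_list (complete_graph 3) (G i) v" .
qed

end

theorem theorem1p4:
  "\<exists>(A::algorithm) (B::nat \<Rightarrow> nat \<Rightarrow> nat).
     (\<forall>n G. dynamic_network n G \<longrightarrow>
        one_round_MemList (complete_graph 3) A G \<and> respects_bandwidth A G (B n (max_degree G))) \<and>
     (\<lambda>(n, \<Delta>). real (B n \<Delta>))
        \<in> O[at_top \<times>\<^sub>F top](\<lambda>(n, \<Delta>). real \<Delta> ^ 2 * ln (ln (real n)))"
proof (intro exI conjI allI impI)
  fix n G
  assume "dynamic_network n G"
  then interpret network n G by unfold_locales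
  show "one_round_MemList (complete_graph 3) triangle_algorithm G"
    by (rule correct)
  show "respects_bandwidth triangle_algorithm G (code_bits n * (3 * (max_degree G)\<^sup>2))"
    using bandwidth by (simp add: W_def)
next
  obtain c where "\<forall>\<^sub>F n in at_top. norm (real (code_bits n)) \<le> c * norm (ln (ln (real n)))"
    using code_bits_asymp by (rule landau_o.bigE)
  \<comment> \<open>Only \<open>n\<close> tends to infinity; the factor \<open>top\<close> demands a
    bound uniform in \<Delta>, on which \<open>code_bits n\<close> does not depend.\<close>
  then have "\<forall>\<^sub>F (n, \<Delta>::nat) in at_top \<times>\<^sub>F top. norm (real (code_bits n)) \<le> c * norm (ln (ln (real n)))"
    by (subst eventually_prod1) (auto simp: trivial_limit_def)
  then show "(\<lambda>(n, \<Delta>). real (code_bits n * (3 * \<Delta>\<^sup>2)))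
      \<in> O[at_top \<times>\<^sub>F top](\<lambda>(n, \<Delta>). real \<Delta> ^ 2 * ln (ln (real n)))"
  proof (intro bigoI[of _ "3 * c"], elim eventually_mono, clarify)
    fix n \<Delta> :: nat
    assume "norm (real (code_bits n)) \<le> c * norm (ln (ln (real n)))"
    from mult_left_mono[OF this, of "3 * real \<Delta> ^ 2"]
    show "norm (real (code_bits n * (3 * \<Delta>\<^sup>2))) \<le> 3 * c * norm (real \<Delta> ^ 2 * ln (ln (real n)))"
      by (simp add: abs_mult algebra_simps)
  qed
qed

end
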